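(* Let $C_1,C_2\in\mathbb{C}$ and let $\alpha_0,\alpha_1\in\mathbb{C}$ with $\alpha_0+\alpha_1=1$. Consider the Hamiltonian system in two variables $t,s$ $$dq_i=\frac{\partial H_1}{\partial p_i}dt+\frac{\partial H_2}{\partial p_i}ds,\qquad dp_i=-\frac{\partial H_1}{\partial q_i}dt-\frac{\partial H_2}{\partial q_i}ds\qquad(i=1,2)$$ with $$\begin{aligned} H_1={}&q_1^2p_1+\tfrac32sp_1-\tfrac{C_1}{2}p_1+\alpha_0q_1-p_2^3+(C_1-3s)p_2^2+\Big(-3s^2+2C_1s+\tfrac t2-\tfrac{C_2}{2}\Big)p_2-\tfrac{q_2^2}{2}+p_1p_2,\\ H_2={}&\tfrac{p_1^2}{2}-\tfrac12(C_2-4C_1s+6s^2-t)p_1+(2\alpha_0+\alpha_1)q_2-p_1p_2^2+2q_1^2p_1p_2+2q_1p_1q_2+2\alpha_0q_1p_2+(C_1-3s)p_1p_2. \end{aligned}$$ Put $f_0:=p_1$ and $f_1:=p_1+4q_1^2p_2-2p_2^2+4q_1q_2+2(C_1-3s)p_2-C_2+4C_1s-6s^2+t$. This system admits the extended affine Weyl group symmetry of type $A_1^{(1)}$ as a group of Bäcklund transformations, with generators acting on $( * )=(q_1,p_1,q_2,p_2,t,s;\alpha_0,\alpha_1)$ by $$\begin{aligned} s_0:( * )\mapsto{}&\Big(q_1+\tfrac{\alpha_0}{f_0},p_1,q_2,p_2,t,s;-\alpha_0,\alpha_1+2\alpha_0\Big),\\ s_1:( * )\mapsto{}&\Big(q_1+\tfrac{\alpha_1}{f_1},\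 p_1-\tfrac{4\alpha_1(q_2+2q_1p_2)}{f_1}+\tfrac{4\alpha_1^2(p_2+2q_1^2-(C_1-3s))}{f_1^2},\\ &\ q_2-\tfrac{2\alpha_1(2p_2-2q_1^2-(C_1-3s))}{f_1}+\tfrac{12\alpha_1^2q_1}{f_1^2}+\tfrac{4\alpha_1^3}{f_1^3},\ p_2-\tfrac{4\alpha_1q_1}{f_1}-\tfrac{2\alpha_1^2}{f_1^2},\ t,s;\ \alpha_0+2\alpha_1,-\alpha_1\Big),\\ \pi:( * )\mapsto{}&\Big(-q_1,\ -f_1,\ -(q_2+4q_1(q_1^2+p_2)-2(C_1-3s)q_1),\ -(p_2+2q_1^2-C_1+3s),\ t,s;\ \alpha_1,\alpha_0\Big). \end{aligned}$$
   Context: A Bäcklund transformation here is a birational transformation of the dependent variables and parameters that takes the system to the same system with the transformed parameters (with $t,s$ and $C_1,C_2$ unchanged). The transformations are regarded as automorphisms of the field of rational functions in the variables and parameters. "Extended affine Weyl group symmetry of type $A_1^{(1)}$ with generators $s_0,s_1,\pi$" means that each of $s_0,s_1,\pi$ is a Bäcklund transformation and that $s_0^2=s_1^2=\pi^2=1$, $\pi s_0=s_1\pi$. *)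

theory Defs
  imports "HOL-Computational_Algebra.Computational_Algebra" "HOL.Complex"
begin

section \<open>The field of rational functions in the variables and parameters\<close>

text \<open>
  The parameters are subject to \<open>\<alpha>\<^sub>0 + \<alpha>\<^sub>1 = 1\<close>, so the rational functions in
  \<open>q\<^sub>1, p\<^sub>1, q\<^sub>2, p\<^sub>2, t, s, \<alpha>\<^sub>0, \<alpha>\<^sub>1\<close> form a field of transcendence degree seven over the complex
  numbers, freely generated by the seven coordinates below, with \<open>\<alpha>\<^sub>1\<close> standing for \<open>1 - \<alpha>\<^sub>0\<close>.
  The polynomial ring is built by iteration; the innermost variable is \<open>\<alpha>\<^sub>0\<close>, the
  outermost one is \<open>q\<^sub>1\<close>.
\<close>

datatype coord = Q1 | P1 | Q2 | P2 | T | S | A0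

type_synonym coord_ring = "complex poly poly poly poly poly poly poly"
type_synonym ratfun = "coord_ring fract"

fun coord_poly :: "coord \<Rightarrow> coord_ring" where
  "coord_poly Q1 = [:0, 1:]"
| "coord_poly P1 = [:[:0, 1:]:]"
| "coord_poly Q2 = [:[:[:0, 1:]:]:]"
| "coord_poly P2 = [:[:[:[:0, 1:]:]:]:]"
| "coord_poly T = [:[:[:[:[:0, 1:]:]:]:]:]"
| "coord_poly S = [:[:[:[:[:[:0, 1:]:]:]:]:]:]"
| "coord_poly A0 = [:[:[:[:[:[:[:0, 1:]:]:]:]:]:]:]"

definition X :: "coord \<Rightarrow> ratfun" where
  "X v = Fract (coord_poly v) 1"

text \<open>The embedding of the polynomials in \<open>\<alpha>\<^sub>0\<close> alone.\<close>

definition param_poly :: "complex poly \<Rightarrow> ratfun" where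
  "param_poly a = Fract [:[:[:[:[:[:a:]:]:]:]:]:] 1"

definition const :: "complex \<Rightarrow> ratfun" where
  "const c = param_poly [:c:]"

abbreviation q1 :: ratfun where "q1 \<equiv> X Q1"
abbreviation p1 :: ratfun where "p1 \<equiv> X P1"
abbreviation q2 :: ratfun where "q2 \<equiv> X Q2"
abbreviation p2 :: ratfun where "p2 \<equiv> X P2"
abbreviation tv :: ratfun where "tv \<equiv> X T"
abbreviation sv :: ratfun where "sv \<equiv> X S"
abbreviation a0 :: ratfun where "a0 \<equiv> X A0"
abbreviation a1 :: ratfun where "a1 \<equiv> 1 - a0"


section \<open>Partial derivatives\<close>

text \<open>
  On the iterated polynomial ring, the derivative with respect to an inner variable acts
  on the coefficients.
\<close>

fun pd_poly :: "coord \<Rightarrow> coord_ring \<Rightarrow> coord_ring" where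
  "pd_poly Q1 = pderiv"
| "pd_poly P1 = map_poly pderiv"
| "pd_poly Q2 = map_poly (map_poly pderiv)"
| "pd_poly P2 = map_poly (map_poly (map_poly pderiv))"
| "pd_poly T = map_poly (map_poly (map_poly (map_poly pderiv)))"
| "pd_poly S = map_poly (map_poly (map_poly (map_poly (map_poly pderiv))))"
| "pd_poly A0 = map_poly (map_poly (map_poly (map_poly (map_poly (map_poly pderiv)))))"

text \<open>
  Extension to fractions by the quotient rule. It does not depend on the representing
  fraction, as lemma \<open>pd_Fract\<close> below shows.
\<close>

definition pd :: "coord \<Rightarrow> ratfun \<Rightarrow> ratfun" where
  "pd v x = (THE y. \<forall>a b. b \<noteq> 0 \<longrightarrow> x = Fract a b \<longrightarrow>
     y = Fract (pd_poly v a * b - a * pd_poly v b) (b * b))"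

definition is_derivation :: "('a::comm_ring_1 \<Rightarrow> 'a) \<Rightarrow> bool" where
  "is_derivation d \<longleftrightarrow>
     (\<forall>x y. d (x + y) = d x + d y) \<and> (\<forall>x y. d (x * y) = d x * y + x * d y)"

lemma is_derivation_0: "is_derivation d \<Longrightarrow> d 0 = 0"
  unfolding is_derivation_def by (metis add_cancel_right_right)

lemma is_derivation_1: "is_derivation d \<Longrightarrow> d 1 = 0"
  unfolding is_derivation_def by (metis add_cancel_right_right mult.right_neutral mult_1)

lemma is_derivation_sum:
  assumes "is_derivation d" shows "d (\<Sum>i\<in>A. f i) = (\<Sum>i\<in>A. d (f i))"
proof (induction A rule: infinite_finite_induct)
  case (insert x F)
  then show ?case using assms by (simp add: is_derivation_def)
qed (simp_all add: is_derivation_0[OF assms])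

lemma is_derivation_pderiv: "is_derivation (pderiv :: 'a::idom poly \<Rightarrow> 'a poly)"
  by (simp add: is_derivation_def pderiv_add pderiv_mult algebra_simps)

lemma is_derivation_map_poly:
  fixes d :: "'a::idom \<Rightarrow> 'a"
  assumes d: "is_derivation d"
  shows "is_derivation (map_poly d)"
proof -
  note d0 = is_derivation_0[OF d]
  have "map_poly d (x + y) = map_poly d x + map_poly d y" for x y
    by (rule poly_eqI) (use d in \<open>simp add: coeff_map_poly d0 is_derivation_def\<close>)
  moreover have "map_poly d (x * y) = map_poly d x * y + x * map_poly d y" for x y
  proof (rule poly_eqI)
    fix n
    have "coeff (map_poly d (x * y)) n = (\<Sum>i\<le>n. d (coeff x i * coeff y (n - i)))"
      by (simp add: coeff_map_poly d0 coeff_mult is_derivation_sum[OF d])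
    also have "\<dots> = coeff (map_poly d x * y + x * map_poly d y) n"
      using d by (simp add: is_derivation_def coeff_mult coeff_map_poly d0 sum.distrib)
    finally show "coeff (map_poly d (x * y)) n = coeff (map_poly d x * y + x * map_poly d y) n" .
  qed
  ultimately show ?thesis by (simp add: is_derivation_def)
qed

lemma is_derivation_pd_poly: "is_derivation (pd_poly v)"
  by (cases v) (simp_all only: pd_poly.simps is_derivation_map_poly is_derivation_pderiv)

lemma pd_Fract:
  assumes "b \<noteq> 0"
  shows "pd v (Fract a b) = Fract (pd_poly v a * b - a * pd_poly v b) (b * b)"
proof -
  let ?d = "pd_poly v"
  have M: "?d (x * y) = ?d x * y + x * ?d y" for x y
    using is_derivation_pd_poly[of v] by (simp add: is_derivation_def)
  have "Fract (?d a * b - a * ?d b) (b * b) = Fract (?d a' * b' - a' * ?d b') (b' * b')"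
    if b': "b' \<noteq> 0" and eq: "Fract a b = Fract a' b'" for a' b'
  proof -
    have e: "a * b' = a' * b" using assms b' eq by (simp add: eq_fract)
    have "?d a * b' + a * ?d b' = ?d a' * b + a' * ?d b" using e M by metis
    with e have "(?d a * b - a * ?d b) * (b' * b') = (?d a' * b' - a' * ?d b') * (b * b)"
      by algebra
    then show ?thesis using assms b' by (simp add: eq_fract)
  qed
  then show ?thesis unfolding pd_def using assms by (intro the_equality) blast+
qed

lemma pd_X: "pd v (X w) = (if v = w then 1 else 0)"
  by (cases v; cases w)
     (simp_all add: X_def pd_Fract map_poly_pCons pderiv_pCons is_derivation_1[OF is_derivation_pd_poly]
        Zero_fract_def One_fract_def one_pCons)

lemma pd_const: "pd v (const c) = 0"
  by (cases v)
     (simp_all add: const_def param_poly_def pd_Fract map_poly_pCons pderiv_pCons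
        Zero_fract_def one_pCons)

lemma is_derivation_pd: "is_derivation (pd v)"
proof -
  have A: "pd_poly v (x + y) = pd_poly v x + pd_poly v y"
    and M: "pd_poly v (x * y) = pd_poly v x * y + x * pd_poly v y" for x y
    using is_derivation_pd_poly[of v] by (simp_all add: is_derivation_def)
  have "pd v (x + y) = pd v x + pd v y" for x y
    by (cases x; cases y) (simp add: pd_Fract A M eq_fract algebra_simps)
  moreover have "pd v (x * y) = pd v x * y + x * pd v y" for x y
    by (cases x; cases y) (simp add: pd_Fract M eq_fract algebra_simps)
  ultimately show ?thesis by (simp add: is_derivation_def)
qed


section \<open>The Hamiltonian system and its Baecklund transformations\<close>

definition H1 :: "complex \<Rightarrow> complex \<Rightarrow> ratfun" where
  "H1 C1 C2 =
     q1^2 * p1 + 3/2 * sv * p1 - const C1 / 2 * p1 + a0 * q1 - p2^3 + (const C1 - 3 * sv) * p2^2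
     + (- 3 * sv^2 + 2 * const C1 * sv + tv / 2 - const C2 / 2) * p2 - q2^2 / 2 + p1 * p2"

definition H2 :: "complex \<Rightarrow> complex \<Rightarrow> ratfun" where
  "H2 C1 C2 =
     p1^2 / 2 - 1/2 * (const C2 - 4 * const C1 * sv + 6 * sv^2 - tv) * p1 + (2 * a0 + a1) * q2
     - p1 * p2^2 + 2 * q1^2 * p1 * p2 + 2 * q1 * p1 * q2 + 2 * a0 * q1 * p2
     + (const C1 - 3 * sv) * p1 * p2"

text \<open>
  Derivative of a rational function along the system: \<open>hamiltonian_flow T (H1 C1 C2) x\<close> and
  \<open>hamiltonian_flow S (H2 C1 C2) x\<close> are the coefficients of \<open>dt\<close> and \<open>ds\<close> in the
  differential of \<open>x\<close> when \<open>dq\<^sub>i\<close> and \<open>dp\<^sub>i\<close> are replaced by the right-hand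
  sides of the system; the parameters are constant.
\<close>

definition hamiltonian_flow :: "coord \<Rightarrow> ratfun \<Rightarrow> ratfun \<Rightarrow> ratfun" where
  "hamiltonian_flow \<tau> H x =
     pd \<tau> x + (\<Sum>(q, p)\<in>{(Q1, P1), (Q2, P2)}. pd p H * pd q x - pd q H * pd p x)"

definition automorphism_over_complex :: "(ratfun \<Rightarrow> ratfun) \<Rightarrow> bool" where
  "automorphism_over_complex \<sigma> \<longleftrightarrow>
     bij \<sigma> \<and> (\<forall>x y. \<sigma> (x + y) = \<sigma> x + \<sigma> y) \<and> (\<forall>x y. \<sigma> (x * y) = \<sigma> x * \<sigma> y) \<and>
     (\<forall>c. \<sigma> (const c) = const c)"

text \<open>
  An automorphism \<open>\<sigma>\<close> of the field substitutes \<open>\<sigma> (X v)\<close> for every coordinate \<open>X v\<close>, so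
  \<open>\<sigma> (pd p H)\<close> is the right-hand side of the system written in the transformed variables and
  with the transformed parameters. The existential clause says that the transformed
  parameters are rational functions of the parameters alone.
\<close>

definition baecklund :: "complex \<Rightarrow> complex \<Rightarrow> (ratfun \<Rightarrow> ratfun) \<Rightarrow> bool" where
  "baecklund C1 C2 \<sigma> \<longleftrightarrow>
     automorphism_over_complex \<sigma> \<and> \<sigma> tv = tv \<and> \<sigma> sv = sv \<and>
     (\<exists>a b. b \<noteq> 0 \<and> \<sigma> a0 = param_poly a / param_poly b) \<and>
     (\<forall>(q, p)\<in>{(Q1, P1), (Q2, P2)}.
        hamiltonian_flow T (H1 C1 C2) (\<sigma> (X q)) = \<sigma> (pd p (H1 C1 C2)) \<and>
        hamiltonian_flow S (H2 C1 C2) (\<sigma> (X q)) = \<sigma> (pd p (H2 C1 C2)) \<and>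
        hamiltonian_flow T (H1 C1 C2) (\<sigma> (X p)) = - \<sigma> (pd q (H1 C1 C2)) \<and>
        hamiltonian_flow S (H2 C1 C2) (\<sigma> (X p)) = - \<sigma> (pd q (H2 C1 C2)))"

definition f0 :: ratfun where
  "f0 = p1"

definition f1 :: "complex \<Rightarrow> complex \<Rightarrow> ratfun" where
  "f1 C1 C2 =
     p1 + 4 * q1^2 * p2 - 2 * p2^2 + 4 * q1 * q2 + 2 * (const C1 - 3 * sv) * p2
     - const C2 + 4 * const C1 * sv - 6 * sv^2 + tv"

end

theory Submission
  imports Defs
begin

text \<open>
  The coefficients of \<open>dt\<close> and \<open>ds\<close> define two derivations of the field, and an automorphism
  fixing \<open>t\<close> and \<open>s\<close> and preserving the functions of the parameters is a Baecklund
  transformation if and only if it commutes with both. Commutation only has to be checked on the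
  coordinates, and it is inherited by compositions. It is therefore enough to treat
  \<open>s\<^sub>0\<close> and \<open>\<pi>\<close>, whose formulas are short, and to put \<open>s\<^sub>1 = \<pi> s\<^sub>0 \<pi>\<close>; the formulas for
  \<open>s\<^sub>1\<close> then come from a substitution, using \<open>\<pi> f\<^sub>1 = - f\<^sub>0\<close>.
\<close>

section \<open>Ring homomorphisms and derivations\<close>

text \<open>Characteristic zero makes the numerals nonzero in the field, so that the fractional
  coefficients of the Hamiltonians can be cleared.\<close>

instance fract :: ("{idom, ring_char_0}") field_char_0
proof
  show "inj (of_nat :: nat \<Rightarrow> 'a fract)"
    by (rule injI) (simp add: of_nat_fract eq_fract)
qed

definition is_hom :: "('a::comm_ring_1 \<Rightarrow> 'b::comm_ring_1) \<Rightarrow> bool" where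
  "is_hom f \<longleftrightarrow> f 1 = 1 \<and> (\<forall>x y. f (x + y) = f x + f y) \<and> (\<forall>x y. f (x * y) = f x * f y)"

lemma is_hom_simps:
  assumes "is_hom f"
  shows "f 1 = 1" "f (x + y) = f x + f y" "f (x * y) = f x * f y" "f 0 = 0"
    "f (- x) = - f x" "f (x - y) = f x - f y" "f (x ^ n) = f x ^ n" "f (numeral k) = numeral k"
proof -
  have one: "f 1 = 1" and add: "\<And>x y. f (x + y) = f x + f y" and mult: "\<And>x y. f (x * y) = f x * f y"
    using assms by (auto simp: is_hom_def)
  have zero: "f 0 = 0" using add[of 0 0] by simp
  have minus: "f (- x) = - f x" for x using add[of x "- x"] zero by (simp add: eq_neg_iff_add_eq_0 add.commute)
  have of_nat: "f (of_nat m) = of_nat m" for m by (induction m) (simp_all add: zero one add)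
  show "f 1 = 1" "f (x + y) = f x + f y" "f (x * y) = f x * f y" "f 0 = 0" "f (- x) = - f x"
    by (fact one add mult zero minus)+
  show "f (x - y) = f x - f y" using add[of x "- y"] minus by simp
  show "f (x ^ n) = f x ^ n" by (induction n) (simp_all add: one mult)
  show "f (numeral k) = numeral k" using of_nat[of "numeral k"] by simp
qed

lemma is_hom_comp: "is_hom f \<Longrightarrow> is_hom g \<Longrightarrow> is_hom (f \<circ> g)"
  by (simp add: is_hom_def)

text \<open>A nonzero element of a field is a unit, and a unit cannot be sent to \<open>0\<close>
  when \<open>0\<close> and \<open>1\<close> differ in the target.\<close>

lemma is_hom_nonzero:
  fixes f :: "'a::field \<Rightarrow> 'b::comm_ring_1"
  assumes "is_hom f" and "x \<noteq> 0"
  shows "f x \<noteq> 0"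
proof
  assume "f x = 0"
  then have "f (x * inverse x) = 0" by (simp only: is_hom_simps[OF assms(1)] mult_zero_left)
  then show False using assms(2) by (simp add: is_hom_simps[OF assms(1)])
qed

lemma is_hom_divide:
  fixes f :: "'a::field \<Rightarrow> 'b::field"
  assumes "is_hom f"
  shows "f (x / y) = f x / f y"
proof (cases "y = 0")
  \<comment> \<open>Both sides are \<open>0\<close> by the convention
    \<open>x / 0 = 0\<close>.\<close>
  case True
  then show ?thesis by (simp add: is_hom_simps[OF assms])
next
  case False
  have "f (x / y) * f y = f x"
    using False by (simp flip: is_hom_simps(3)[OF assms])
  then show ?thesis using is_hom_nonzero[OF assms False] by (simp add: eq_divide_eq)
qed

lemma is_derivation_simps:
  assumes "is_derivation d"
  shows "d (x + y) = d x + d y" "d (x * y) = d x * y + x * d y" "d 0 = 0" "d 1 = 0"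
    "d (- x) = - d x" "d (x - y) = d x - d y" "d (x ^ n) = of_nat n * x ^ (n - 1) * d x"
    "d (numeral k) = 0"
proof -
  have add: "\<And>x y. d (x + y) = d x + d y" and mult: "\<And>x y. d (x * y) = d x * y + x * d y"
    using assms by (auto simp: is_derivation_def)
  note zero = is_derivation_0[OF assms] and one = is_derivation_1[OF assms]
  have minus: "d (- x) = - d x" for x using add[of x "- x"] zero by (simp add: eq_neg_iff_add_eq_0 add.commute)
  have of_nat: "d (of_nat m) = 0" for m by (induction m) (simp_all add: zero one add)
  show "d (x + y) = d x + d y" "d (x * y) = d x * y + x * d y" "d 0 = 0" "d 1 = 0" "d (- x) = - d x"
    by (fact add mult zero one minus)+
  show "d (x - y) = d x - d y" using add[of x "- y"] minus by simp
  show "d (x ^ n) = of_nat n * x ^ (n - 1) * d x"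
  proof (induction n)
    case (Suc n)
    then show ?case by (cases n) (simp_all add: one mult algebra_simps)
  qed (simp add: one)
  show "d (numeral k) = 0" using of_nat[of "numeral k"] by simp
qed

text \<open>The product rule for \<open>x / y * y = x\<close>, solved for the derivative of
  \<open>x / y\<close>.\<close>

lemma is_derivation_divide:
  fixes d :: "'a::field \<Rightarrow> 'a"
  assumes "is_derivation d" and "y \<noteq> 0"
  shows "d (x / y) = (d x - x / y * d y) / y"
  using is_derivation_simps(2)[OF assms(1), of "x / y" y] assms(2) by (simp add: field_simps)

lemma is_derivation_divide_numeral:
  fixes d :: "'a::field_char_0 \<Rightarrow> 'a"
  assumes "is_derivation d"
  shows "d (x / numeral k) = d x / numeral k"
  using is_derivation_divide[OF assms, of "numeral k"] by (simp add: is_derivation_simps[OF assms])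


section \<open>Substitutions in the field of rational functions\<close>

definition poly_lift :: "('a::comm_ring_1 \<Rightarrow> 'b::comm_ring_1) \<Rightarrow> 'b \<Rightarrow> 'a poly \<Rightarrow> 'b" where
  "poly_lift f x p = poly (map_poly f p) x"

lemma poly_lift_pCons:
  "is_hom f \<Longrightarrow> poly_lift f x (pCons a p) = f a + x * poly_lift f x p"
  by (simp add: poly_lift_def map_poly_pCons is_hom_simps)

lemma poly_lift_0 [simp]: "poly_lift f x 0 = 0"
  by (simp add: poly_lift_def)

lemma is_hom_poly_lift:
  assumes f: "is_hom f"
  shows "is_hom (poly_lift f x)"
proof -
  have add: "poly_lift f x (p + q) = poly_lift f x p + poly_lift f x q" for p q
    by (induction p q rule: poly_induct2)
       (simp_all add: poly_lift_pCons[OF f] is_hom_simps[OF f] algebra_simps)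
  \<comment> \<open>The product of \<open>pCons a p\<close> and \<open>q\<close> unfolds to
    \<open>smult a q + pCons 0 (p * q)\<close>, so multiplicativity needs this case first.\<close>
  have smult: "poly_lift f x (smult a p) = f a * poly_lift f x p" for a p
    by (induction p) (simp_all add: poly_lift_pCons[OF f] is_hom_simps[OF f] algebra_simps)
  have "poly_lift f x (p * q) = poly_lift f x p * poly_lift f x q" for p q
    by (induction p)
       (simp_all add: poly_lift_pCons[OF f] is_hom_simps[OF f] add smult algebra_simps)
  then show ?thesis
    using add by (simp add: is_hom_def one_pCons poly_lift_pCons[OF f] is_hom_simps[OF f])
qed

text \<open>The nesting mirrors \<open>coord_ring\<close>: the innermost lift substitutes for
  \<alpha>0, the outermost for q1. Values lie in the field because an image may have a
  denominator.\<close>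

definition eval :: "(coord \<Rightarrow> ratfun) \<Rightarrow> coord_ring \<Rightarrow> ratfun" where
  "eval g = poly_lift (poly_lift (poly_lift (poly_lift (poly_lift (poly_lift (poly_lift const
     (g A0)) (g S)) (g T)) (g P2)) (g Q2)) (g P1)) (g Q1)"

definition const_poly :: "complex \<Rightarrow> coord_ring" where
  "const_poly c = [:[:[:[:[:[:[:c:]:]:]:]:]:]:]"

abbreviation emb :: "'a::idom \<Rightarrow> 'a fract" where "emb r \<equiv> Fract r 1"

lemma is_hom_emb: "is_hom emb"
  by (simp add: is_hom_def One_fract_def)

lemma emb_eq_0_iff [simp]: "emb r = 0 \<longleftrightarrow> r = 0"
  by (simp add: Zero_fract_def eq_fract)

lemma const_eq: "const c = emb (const_poly c)"
  by (simp add: const_def param_poly_def const_poly_def)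

lemma is_hom_const: "is_hom const"
  by (simp add: is_hom_def const_eq const_poly_def One_fract_def one_pCons mult.commute)

lemma is_hom_eval: "is_hom (eval g)"
  unfolding eval_def by (intro is_hom_poly_lift is_hom_const)

lemma eval_const: "eval g (const_poly c) = const c"
  by (simp add: eval_def const_poly_def poly_lift_pCons is_hom_poly_lift is_hom_const)

lemma eval_coord: "eval g (coord_poly v) = g v"
  by (cases v)
     (simp_all add: eval_def poly_lift_pCons is_hom_poly_lift is_hom_const is_hom_simps)

section \<open>Induction over polynomials and rational functions\<close>

definition ring_closed :: "('a::comm_ring_1 \<Rightarrow> bool) \<Rightarrow> bool" where
  "ring_closed P \<longleftrightarrow> (\<forall>x y. P x \<longrightarrow> P y \<longrightarrow> P (x + y) \<and> P (x * y))"

text \<open>Horner's scheme: \<open>pCons a p\<close> is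
  \<open>[:a:] + [:0, 1:] * p\<close>.\<close>

lemma poly_closure_induct:
  assumes P: "ring_closed P" and const: "\<And>a. P [:a:]" and var: "P [:0, 1:]"
  shows "P p"
proof (induction p)
  case 0
  show ?case using const[of 0] by simp
next
  case (pCons a p)
  have "P ([:a:] + [:0, 1:] * p)"
    using P const var pCons by (simp only: ring_closed_def)
  then show ?case by simp
qed

text \<open>Embedding coefficients as constant polynomials respects sums and products, so closure
  passes down to the coefficient ring. This lets the one-variable induction be iterated.\<close>

lemma ring_closed_const: "ring_closed P \<Longrightarrow> ring_closed (\<lambda>a. P [:a:])"
  unfolding ring_closed_def
proof (intro allI impI)
  fix x y
  assume "\<forall>x y. P x \<longrightarrow> P y \<longrightarrow> P (x + y) \<and> P (x * y)" and "P [:x:]" and "P [:y:]"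
  then have "P ([:x:] + [:y:])" and "P ([:x:] * [:y:])" by blast+
  then show "P [:x + y:] \<and> P [:x * y:]" by (simp add: mult.commute)
qed

lemma coord_ring_induct:
  assumes const: "\<And>c. P (const_poly c)" and coord: "\<And>v. P (coord_poly v)"
    and closed: "ring_closed P"
  shows "P r"
proof -
  note c1 = ring_closed_const[OF closed]
  note c2 = ring_closed_const[OF c1]
  note c3 = ring_closed_const[OF c2]
  note c4 = ring_closed_const[OF c3]
  note c5 = ring_closed_const[OF c4]
  note c6 = ring_closed_const[OF c5]
  note coord = coord[of Q1] coord[of P1] coord[of Q2] coord[of P2] coord[of T] coord[of S] coord[of A0]
  \<comment> \<open>Starting from complex constants, each application of
    \<open>poly_closure_induct\<close> admits one more variable, from \<alpha>0 outwards to
    q1.\<close>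
  have "P [:[:[:[:[:[:[:c:]:]:]:]:]:]:]" for c using const by (simp add: const_poly_def)
  then have "P [:[:[:[:[:[:a:]:]:]:]:]:]" for a
    by (rule poly_closure_induct[OF c6]) (use coord in simp_all)
  then have "P [:[:[:[:[:a:]:]:]:]:]" for a
    by (rule poly_closure_induct[OF c5]) (use coord in simp_all)
  then have "P [:[:[:[:a:]:]:]:]" for a
    by (rule poly_closure_induct[OF c4]) (use coord in simp_all)
  then have "P [:[:[:a:]:]:]" for a
    by (rule poly_closure_induct[OF c3]) (use coord in simp_all)
  then have "P [:[:a:]:]" for a
    by (rule poly_closure_induct[OF c2]) (use coord in simp_all)
  then have "P [:a:]" for a
    by (rule poly_closure_induct[OF c1]) (use coord in simp_all)
  then show ?thesis
    by (rule poly_closure_induct[OF closed]) (use coord in simp_all)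
qed

text \<open>Every element is a quotient of embedded polynomials. Identities between homomorphisms or
  derivations are thereby reduced to constants and coordinates.\<close>

lemma ratfun_induct:
  assumes const: "\<And>c. P (const c)" and X: "\<And>v. P (X v)" and closed: "ring_closed P"
    and divide: "\<And>x y. P x \<Longrightarrow> P y \<Longrightarrow> y \<noteq> 0 \<Longrightarrow> P (x / y)"
  shows "P x"
proof -
  have emb: "P (emb r)" for r
  proof (rule coord_ring_induct[where P = "\<lambda>r. P (emb r)"])
    show "ring_closed (\<lambda>r. P (emb r))"
      using closed unfolding ring_closed_def is_hom_simps(2,3)[OF is_hom_emb] by blast
  qed (use const X in \<open>simp_all add: const_eq X_def\<close>)
  show ?thesis
  proof (cases x)
    case (Fract a b)
    then have "emb b \<noteq> 0" by simp
    then have "P (emb a / emb b)" using emb divide by blast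
    then show ?thesis using Fract by simp
  qed
qed

section \<open>Extension of homomorphisms to the fraction field\<close>

definition fract_lift :: "('a::idom \<Rightarrow> 'b::field) \<Rightarrow> 'a fract \<Rightarrow> 'b" where
  "fract_lift f x = (THE y. \<forall>a b. b \<noteq> 0 \<longrightarrow> x = Fract a b \<longrightarrow> y = f a / f b)"

text \<open>Injectivity keeps the image of a denominator nonzero; independence of the representative
  is then the image of the cross-multiplied equation.\<close>

lemma fract_lift_Fract:
  assumes f: "is_hom f" "\<And>r. f r = 0 \<Longrightarrow> r = 0" and "b \<noteq> 0"
  shows "fract_lift f (Fract a b) = f a / f b"
  unfolding fract_lift_def
proof (rule the_equality)
  show "\<forall>a' b'. b' \<noteq> 0 \<longrightarrow> Fract a b = Fract a' b' \<longrightarrow> f a / f b = f a' / f b'"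
  proof (intro allI impI)
    fix a' b'
    assume "b' \<noteq> 0" and "Fract a b = Fract a' b'"
    then have "a * b' = a' * b" using assms(3) by (simp add: eq_fract)
    then have "f a * f b' = f a' * f b" by (metis is_hom_simps(3)[OF f(1)])
    moreover have "f b \<noteq> 0" "f b' \<noteq> 0" using f(2) assms(3) \<open>b' \<noteq> 0\<close> by blast+
    ultimately show "f a / f b = f a' / f b'" by (simp add: frac_eq_eq)
  qed
qed (use assms(3) in blast)

lemma is_hom_fract_lift:
  assumes f: "is_hom f" "\<And>r. f r = 0 \<Longrightarrow> r = 0"
  shows "is_hom (fract_lift f)"
proof -
  have nz: "f r \<noteq> 0" if "r \<noteq> 0" for r using f(2) that by blast
  note lift = fract_lift_Fract[OF f]
  have "fract_lift f (x + y) = fract_lift f x + fract_lift f y" for x y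
    by (cases x; cases y) (simp add: lift nz is_hom_simps[OF f(1)] field_simps)
  moreover have "fract_lift f (x * y) = fract_lift f x * fract_lift f y" for x y
    by (cases x; cases y) (simp add: lift is_hom_simps[OF f(1)])
  moreover have "fract_lift f 1 = 1"
    by (simp add: One_fract_def lift is_hom_simps[OF f(1)])
  ultimately show ?thesis by (simp add: is_hom_def)
qed

text \<open>
  A substitution \<open>g\<close> with values in the localization at \<open>d\<close> that fixes \<open>d\<close> and is an
  involution on the coordinates maps a polynomial \<open>r\<close> to some \<open>r' / d ^ n\<close> such that \<open>r'\<close> is
  mapped to \<open>d ^ n * r\<close>. Hence no nonzero polynomial is annihilated, and the substitution
  extends to fractions.
\<close>

lemma involution_exists:
  fixes d :: coord_ring
  assumes d: "d \<noteq> 0" "eval g d = emb d"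
    and inv: "\<And>v. \<exists>n r. g v * emb d ^ n = emb r \<and> eval g r = emb d ^ n * X v"
  shows "\<exists>\<sigma>. is_hom \<sigma> \<and> (\<forall>c. \<sigma> (const c) = const c) \<and> (\<forall>v. \<sigma> (X v) = g v) \<and> \<sigma> \<circ> \<sigma> = id"
proof -
  let ?e = "eval g" and ?D = "emb d"
  note e = is_hom_simps[OF is_hom_eval[of g]] and emb = is_hom_simps[OF is_hom_emb]
  have D: "?D \<noteq> 0" using d(1) by simp
  \<comment> \<open>The hypothesis \<open>inv\<close>, extended from coordinates to all
    polynomials.\<close>
  let ?P = "\<lambda>r. \<exists>n r'. ?e r * ?D ^ n = emb r' \<and> ?e r' = ?D ^ n * emb r"
  have P: "?P r" for r
  proof (rule coord_ring_induct[where P = ?P])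
    show "?P (const_poly c)" for c
      by (intro exI[of _ 0] exI[of _ "const_poly c"]) (simp add: eval_const const_eq)
    show "?P (coord_poly v)" for v
      using inv[of v] by (simp add: eval_coord X_def)
    show "ring_closed ?P"
      unfolding ring_closed_def
    proof (intro allI impI, elim exE conjE)
      fix x y m n x' y'
      assume x: "?e x * ?D ^ m = emb x'" "?e x' = ?D ^ m * emb x"
        and y: "?e y * ?D ^ n = emb y'" "?e y' = ?D ^ n * emb y"
      \<comment> \<open>The common denominator is \<open>d ^ (m + n)\<close>. The extra factors
        \<open>d ^ n\<close> and \<open>d ^ m\<close> keep their values under \<open>?e\<close>
        because \<open>d\<close> is fixed.\<close>
      have "?e (x + y) * ?D ^ (m + n) = emb (x' * d ^ n + y' * d ^ m)"
        unfolding emb e x(1)[symmetric] y(1)[symmetric] by (simp only: power_add algebra_simps)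
      moreover have "?e (x' * d ^ n + y' * d ^ m) = ?D ^ (m + n) * emb (x + y)"
        unfolding emb e x(2) y(2) d(2) by (simp only: power_add algebra_simps)
      ultimately have 1: "?P (x + y)" by blast
      have "?e (x * y) * ?D ^ (m + n) = emb (x' * y')"
        unfolding emb e x(1)[symmetric] y(1)[symmetric] by (simp only: power_add ac_simps)
      moreover have "?e (x' * y') = ?D ^ (m + n) * emb (x * y)"
        unfolding emb e x(2) y(2) by (simp only: power_add ac_simps)
      ultimately have "?P (x * y)" by blast
      with 1 show "?P (x + y) \<and> ?P (x * y)" ..
    qed
  qed
  have inj: "r = 0" if "?e r = 0" for r
  proof -
    obtain n r' where r': "?e r * ?D ^ n = emb r'" "?e r' = ?D ^ n * emb r" using P by blast
    then have "r' = 0" using that by simp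
    then show ?thesis using r'(2) D by (simp add: e)
  qed
  define \<sigma> where "\<sigma> = fract_lift ?e"
  have \<sigma>: "is_hom \<sigma>"
    unfolding \<sigma>_def using is_hom_eval inj by (rule is_hom_fract_lift)
  have \<sigma>_emb: "\<sigma> (emb r) = ?e r" for r
    unfolding \<sigma>_def by (subst fract_lift_Fract[OF is_hom_eval inj]) (simp_all add: e)
  have const: "\<sigma> (const c) = const c" for c
    unfolding const_eq[of c] \<sigma>_emb by (simp add: eval_const const_eq)
  have X: "\<sigma> (X v) = g v" for v
    unfolding X_def \<sigma>_emb by (rule eval_coord)
  have "\<sigma> (\<sigma> (X v)) = X v" for v
  proof -
    obtain n r where r: "g v * ?D ^ n = emb r" "?e r = ?D ^ n * X v" using inv by blast
    \<comment> \<open>Apply \<open>\<sigma>\<close> to the first equation, with \<open>?D\<close>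
      fixed, and insert the second.\<close>
    then have "\<sigma> (g v) * ?D ^ n = ?D ^ n * X v"
      by (metis \<sigma>_emb d(2) is_hom_simps(3,7)[OF \<sigma>])
    then show ?thesis using D by (simp add: X)
  qed
  then have "(\<sigma> \<circ> \<sigma>) x = x" for x
    by (induction x rule: ratfun_induct)
       (simp_all add: const ring_closed_def is_hom_simps[OF \<sigma>] is_hom_divide[OF \<sigma>])
  then have "\<sigma> \<circ> \<sigma> = id" by auto
  then show ?thesis using \<sigma> const X by blast
qed


section \<open>The flows of the Hamiltonian system\<close>

lemma hamiltonian_flow_eq:
  "hamiltonian_flow \<tau> H x =
     pd \<tau> x + (pd P1 H * pd Q1 x - pd Q1 H * pd P1 x) + (pd P2 H * pd Q2 x - pd Q2 H * pd P2 x)"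
  by (simp add: hamiltonian_flow_def)

lemma is_derivation_flow: "is_derivation (hamiltonian_flow \<tau> H)"
  unfolding is_derivation_def hamiltonian_flow_eq
  by (simp add: is_derivation_simps(1,2)[OF is_derivation_pd] algebra_simps)

lemma flow_const: "hamiltonian_flow \<tau> H (const c) = 0"
  by (simp add: hamiltonian_flow_eq pd_const)

lemma flow_X:
  "hamiltonian_flow \<tau> H q1 = pd \<tau> q1 + pd P1 H" "hamiltonian_flow \<tau> H p1 = pd \<tau> p1 - pd Q1 H"
  "hamiltonian_flow \<tau> H q2 = pd \<tau> q2 + pd P2 H" "hamiltonian_flow \<tau> H p2 = pd \<tau> p2 - pd Q2 H"
  "hamiltonian_flow \<tau> H tv = pd \<tau> tv" "hamiltonian_flow \<tau> H sv = pd \<tau> sv"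
  "hamiltonian_flow \<tau> H a0 = pd \<tau> a0"
  by (simp_all add: hamiltonian_flow_eq pd_X)

lemmas pd_simps = is_derivation_simps[OF is_derivation_pd]
  is_derivation_divide_numeral[OF is_derivation_pd] pd_X pd_const

lemma pd_H1:
  "pd P1 (H1 C1 C2) = q1^2 + 3/2 * sv - const C1 / 2 + p2"
  "pd Q1 (H1 C1 C2) = 2 * q1 * p1 + a0"
  "pd P2 (H1 C1 C2) = - 3 * p2^2 + 2 * (const C1 - 3 * sv) * p2
     + (- 3 * sv^2 + 2 * const C1 * sv + tv / 2 - const C2 / 2) + p1"
  "pd Q2 (H1 C1 C2) = - q2"
  by (simp_all add: H1_def pd_simps algebra_simps)

text \<open>The derivative in p1 is half of \<open>f0 + f1\<close>. Since \<pi> sends p1 to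
  \<open>- f1\<close> and \<open>f1\<close> to \<open>- p1\<close>, it changes the sign of this
  expression, just as it does for q1.\<close>

lemma pd_H2:
  "pd P1 (H2 C1 C2) = (p1 + f1 C1 C2) / 2"
  "pd Q1 (H2 C1 C2) = 4 * q1 * p1 * p2 + 2 * p1 * q2 + 2 * a0 * p2"
  "pd P2 (H2 C1 C2) = - 2 * p1 * p2 + 2 * q1^2 * p1 + 2 * a0 * q1 + (const C1 - 3 * sv) * p1"
  "pd Q2 (H2 C1 C2) = 2 * a0 + a1 + 2 * q1 * p1"
  by (simp_all add: H2_def f1_def pd_simps algebra_simps)

text \<open>The elements on which \<open>d\<close> and \<open>\<sigma>\<close> commute are closed
  under sums, products and quotients; for quotients, \<open>\<sigma> y\<close> must be nonzero to
  apply the quotient rule.\<close>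

lemma derivation_commutes_hom:
  assumes d: "is_derivation d" and \<sigma>: "is_hom \<sigma>"
    and const: "\<And>c. d (const c) = 0" "\<And>c. \<sigma> (const c) = const c"
    and X: "\<And>v. d (\<sigma> (X v)) = \<sigma> (d (X v))"
  shows "d (\<sigma> x) = \<sigma> (d x)"
proof (induction x rule: ratfun_induct)
  fix x y
  assume "d (\<sigma> x) = \<sigma> (d x)" "d (\<sigma> y) = \<sigma> (d y)" and y: "y \<noteq> 0"
  moreover have "\<sigma> y \<noteq> 0" using \<sigma> y by (rule is_hom_nonzero)
  ultimately show "d (\<sigma> (x / y)) = \<sigma> (d (x / y))"
    by (simp add: is_hom_divide[OF \<sigma>] is_hom_simps[OF \<sigma>] is_derivation_divide[OF d])
qed (use const X in \<open>simp_all add: ring_closed_def is_hom_simps[OF \<sigma>] is_derivation_simps[OF d]\<close>)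

text \<open>Commutation is required on the whole field, not only on coordinates, so that composition
  preserves it directly.\<close>

definition preserves_flows :: "complex \<Rightarrow> complex \<Rightarrow> (ratfun \<Rightarrow> ratfun) \<Rightarrow> bool" where
  "preserves_flows C1 C2 \<sigma> \<longleftrightarrow>
     (\<forall>x. hamiltonian_flow T (H1 C1 C2) (\<sigma> x) = \<sigma> (hamiltonian_flow T (H1 C1 C2) x)) \<and>
     (\<forall>x. hamiltonian_flow S (H2 C1 C2) (\<sigma> x) = \<sigma> (hamiltonian_flow S (H2 C1 C2) x))"

lemma preserves_flowsI:
  assumes "is_hom \<sigma>" and "\<And>c. \<sigma> (const c) = const c"
    and "\<And>v. hamiltonian_flow T (H1 C1 C2) (\<sigma> (X v)) = \<sigma> (hamiltonian_flow T (H1 C1 C2) (X v))"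
    and "\<And>v. hamiltonian_flow S (H2 C1 C2) (\<sigma> (X v)) = \<sigma> (hamiltonian_flow S (H2 C1 C2) (X v))"
  shows "preserves_flows C1 C2 \<sigma>"
  unfolding preserves_flows_def
  by (blast intro: derivation_commutes_hom is_derivation_flow flow_const assms)

lemma preserves_flows_comp:
  "preserves_flows C1 C2 \<sigma> \<Longrightarrow> preserves_flows C1 C2 \<rho> \<Longrightarrow> preserves_flows C1 C2 (\<sigma> \<circ> \<rho>)"
  by (simp add: preserves_flows_def)

text \<open>The canonical coordinates have no explicit dependence on t or s, so commutation at them
  is exactly the transformed system. An involution is its own inverse, which gives
  bijectivity.\<close>

lemma baecklundI:
  assumes \<sigma>: "is_hom \<sigma>" "\<And>c. \<sigma> (const c) = const c" "\<sigma> \<circ> \<sigma> = id"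
    and ts: "\<sigma> tv = tv" "\<sigma> sv = sv" and a0: "\<sigma> a0 = param_poly a"
    and flows: "preserves_flows C1 C2 \<sigma>"
  shows "baecklund C1 C2 \<sigma>"
proof -
  have "bij \<sigma>" using \<sigma>(3) by (rule o_bij) (fact \<sigma>(3))
  then have "automorphism_over_complex \<sigma>"
    by (simp add: automorphism_over_complex_def \<sigma>(2) is_hom_simps[OF \<sigma>(1)])
  moreover have "\<exists>a b. b \<noteq> 0 \<and> \<sigma> a0 = param_poly a / param_poly b"
    by (intro exI[of _ a] exI[of _ 1]) (simp add: a0 param_poly_def one_pCons)
  moreover have
    "hamiltonian_flow T (H1 C1 C2) (\<sigma> x) = \<sigma> (hamiltonian_flow T (H1 C1 C2) x)"
    "hamiltonian_flow S (H2 C1 C2) (\<sigma> x) = \<sigma> (hamiltonian_flow S (H2 C1 C2) x)" for x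
    using flows by (auto simp: preserves_flows_def)
  ultimately show ?thesis
    unfolding baecklund_def using ts
    by (simp add: flow_X pd_X is_hom_simps[OF \<sigma>(1)])
qed


section \<open>The generators\<close>

fun s0_subst :: "coord \<Rightarrow> ratfun" where
  "s0_subst Q1 = q1 + a0 / p1"
| "s0_subst A0 = - a0"
| "s0_subst v = X v"

fun pi_subst :: "complex \<Rightarrow> complex \<Rightarrow> coord \<Rightarrow> ratfun" where
  "pi_subst C1 C2 Q1 = - q1"
| "pi_subst C1 C2 P1 = - f1 C1 C2"
| "pi_subst C1 C2 Q2 = - (q2 + 4 * q1 * (q1^2 + p2) - 2 * (const C1 - 3 * sv) * q1)"
| "pi_subst C1 C2 P2 = - (p2 + 2 * q1^2 - const C1 + 3 * sv)"
| "pi_subst C1 C2 A0 = a1"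
| "pi_subst C1 C2 v = X v"

lemma X_nonzero: "X v \<noteq> 0"
  by (cases v) (simp_all add: X_def)

lemma coord_fixed:
  assumes "g v = X v"
  shows "\<exists>n r. g v * emb d ^ n = emb r \<and> eval g r = emb d ^ n * X v"
  using assms by (intro exI[of _ 0] exI[of _ "coord_poly v"]) (simp add: X_def eval_coord)

text \<open>The only denominator is p1, which is fixed, so \<open>d\<close> is p1. The numerator
  \<open>q1 * p1 + a0\<close> of the image of q1 goes back to \<open>q1 * p1\<close>, as \<alpha>0
  changes sign.\<close>

lemma s0_exists:
  "\<exists>\<sigma>. is_hom \<sigma> \<and> (\<forall>c. \<sigma> (const c) = const c) \<and> (\<forall>v. \<sigma> (X v) = s0_subst v) \<and> \<sigma> \<circ> \<sigma> = id"
proof (rule involution_exists[where d = "coord_poly P1"])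
  note emb = is_hom_simps[OF is_hom_emb] X_def[symmetric]
    and eval = is_hom_simps[OF is_hom_eval] eval_coord
  show "\<exists>n r. s0_subst v * emb (coord_poly P1) ^ n = emb r \<and>
      eval s0_subst r = emb (coord_poly P1) ^ n * X v" for v
  proof (cases v)
    case Q1
    have "s0_subst Q1 * emb (coord_poly P1) ^ 1 = emb (coord_poly Q1 * coord_poly P1 + coord_poly A0)"
      unfolding emb using X_nonzero[of P1] by (simp add: distrib_right)
    moreover have "eval s0_subst (coord_poly Q1 * coord_poly P1 + coord_poly A0)
        = emb (coord_poly P1) ^ 1 * q1"
      unfolding emb eval using X_nonzero[of P1] by (simp add: distrib_right)
    ultimately show ?thesis unfolding Q1 by blast
  next
    case A0
    have "s0_subst A0 * emb (coord_poly P1) ^ 0 = emb (- coord_poly A0)"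
      unfolding emb by simp
    moreover have "eval s0_subst (- coord_poly A0) = emb (coord_poly P1) ^ 0 * a0"
      unfolding emb eval by simp
    ultimately show ?thesis unfolding A0 by blast
  qed (use coord_fixed[of s0_subst v] in simp_all)
  show "eval s0_subst (coord_poly P1) = emb (coord_poly P1)"
    unfolding emb eval by simp
qed simp

text \<open>All images are polynomial, so \<open>d = 1\<close> and exponent \<open>0\<close>
  suffice. What remains is to evaluate the substitution twice.\<close>

lemma pi_exists:
  "\<exists>\<sigma>. is_hom \<sigma> \<and> (\<forall>c. \<sigma> (const c) = const c) \<and> (\<forall>v. \<sigma> (X v) = pi_subst C1 C2 v) \<and>
     \<sigma> \<circ> \<sigma> = id"
proof (rule involution_exists[where d = 1])
  let ?g = "pi_subst C1 C2"
  note emb = is_hom_simps[OF is_hom_emb] X_def[symmetric] const_eq[symmetric]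
    and eval = is_hom_simps[OF is_hom_eval] eval_coord eval_const
  let ?q1 = "coord_poly Q1" and ?p1 = "coord_poly P1" and ?q2 = "coord_poly Q2"
    and ?p2 = "coord_poly P2" and ?t = "coord_poly T" and ?s = "coord_poly S"
    and ?C1 = "const_poly C1" and ?C2 = "const_poly C2"
  have *: "\<exists>n r. ?g v * emb 1 ^ n = emb r \<and> eval ?g r = emb 1 ^ n * X v"
    if "?g v = emb r" "eval ?g r = X v" for v r
    using that by (intro exI[of _ 0] exI[of _ r]) simp
  show "\<exists>n r. ?g v * emb 1 ^ n = emb r \<and> eval ?g r = emb 1 ^ n * X v" for v
  proof (cases v)
    case Q1
    show ?thesis unfolding Q1
      by (rule *[of _ "- ?q1"]) (unfold emb eval, simp_all)
  next
    case P1
    show ?thesis unfolding P1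
      by (rule *[of _ "- (?p1 + 4 * ?q1^2 * ?p2 - 2 * ?p2^2 + 4 * ?q1 * ?q2
             + 2 * (?C1 - 3 * ?s) * ?p2 - ?C2 + 4 * ?C1 * ?s - 6 * ?s^2 + ?t)"])
         (unfold emb eval pi_subst.simps f1_def, simp_all add: algebra_simps power2_eq_square)
  next
    case Q2
    show ?thesis unfolding Q2
      by (rule *[of _ "- (?q2 + 4 * ?q1 * (?q1^2 + ?p2) - 2 * (?C1 - 3 * ?s) * ?q1)"])
         (unfold emb eval pi_subst.simps, simp_all add: algebra_simps power2_eq_square)
  next
    case P2
    show ?thesis unfolding P2
      by (rule *[of _ "- (?p2 + 2 * ?q1^2 - ?C1 + 3 * ?s)"])
         (unfold emb eval pi_subst.simps, simp_all add: algebra_simps power2_eq_square)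
  next
    case A0
    show ?thesis unfolding A0
      by (rule *[of _ "1 - coord_poly A0"]) (unfold emb eval, simp_all)
  qed (use coord_fixed[of ?g v] in simp_all)
  show "eval ?g 1 = emb 1"
    unfolding emb eval by simp
qed simp

text \<open>Behind the computation, \<open>2 * q1 * p1 + a0\<close> is fixed. Along t, the
  derivative of \<open>a0 / p1\<close> is \<open>a0 * (2 * q1 * p1 + a0) / p1^2\<close>, the
  difference of \<open>(q1 + a0 / p1)^2\<close> and \<open>q1^2\<close>.\<close>

lemma s0_preserves_flows:
  assumes \<sigma>: "is_hom \<sigma>" "\<And>c. \<sigma> (const c) = const c" and X: "\<And>v. \<sigma> (X v) = s0_subst v"
  shows "preserves_flows C1 C2 \<sigma>"
proof (rule preserves_flowsI[OF \<sigma>])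
  note simps = X pd_X flow_X pd_H1 pd_H2 f1_def is_hom_simps[OF \<sigma>(1)] \<sigma>(2) is_hom_divide[OF \<sigma>(1)]
    is_derivation_simps[OF is_derivation_flow] is_derivation_divide[OF is_derivation_flow X_nonzero]
  show "hamiltonian_flow T (H1 C1 C2) (\<sigma> (X v)) = \<sigma> (hamiltonian_flow T (H1 C1 C2) (X v))" for v
    using X_nonzero[of P1] by (cases v) (simp_all add: simps field_simps power2_eq_square)
  show "hamiltonian_flow S (H2 C1 C2) (\<sigma> (X v)) = \<sigma> (hamiltonian_flow S (H2 C1 C2) (X v))" for v
    using X_nonzero[of P1] by (cases v) (simp_all add: simps field_simps power2_eq_square)
qed

text \<open>The images are polynomials, so only polynomial identities arise. The explicit t and s in
  the images contribute through the flows of \<open>tv\<close> and \<open>sv\<close>.\<close>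

lemma pi_preserves_flows:
  assumes \<sigma>: "is_hom \<sigma>" "\<And>c. \<sigma> (const c) = const c" and X: "\<And>v. \<sigma> (X v) = pi_subst C1 C2 v"
  shows "preserves_flows C1 C2 \<sigma>"
proof (rule preserves_flowsI[OF \<sigma>])
  note simps = X pd_X flow_X pd_H1 pd_H2 f1_def is_hom_simps[OF \<sigma>(1)] \<sigma>(2) is_hom_divide[OF \<sigma>(1)]
    is_derivation_simps[OF is_derivation_flow] flow_const
  show "hamiltonian_flow T (H1 C1 C2) (\<sigma> (X v)) = \<sigma> (hamiltonian_flow T (H1 C1 C2) (X v))" for v
    by (cases v) (simp_all add: simps field_simps power2_eq_square power3_eq_cube)
  show "hamiltonian_flow S (H2 C1 C2) (\<sigma> (X v)) = \<sigma> (hamiltonian_flow S (H2 C1 C2) (X v))" for v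
    by (cases v) (simp_all add: simps field_simps power2_eq_square power3_eq_cube)
qed

section \<open>The group generators and their relations\<close>

lemma is_hom_param_poly: "is_hom param_poly"
  by (simp add: is_hom_def param_poly_def One_fract_def one_pCons mult.commute)

lemma param_poly_var: "param_poly [:0, 1:] = a0"
  by (simp add: param_poly_def X_def)

theorem theorem4p1:
  fixes C1 C2 :: complex
  shows "\<exists>s0 s1 \<pi> :: ratfun \<Rightarrow> ratfun.
    map s0 [q1, p1, q2, p2, tv, sv, a0, a1] =
      [q1 + a0 / f0, p1, q2, p2, tv, sv, - a0, a1 + 2 * a0] \<and>
    map s1 [q1, p1, q2, p2, tv, sv, a0, a1] =
      [q1 + a1 / f1 C1 C2,
       p1 - 4 * a1 * (q2 + 2 * q1 * p2) / f1 C1 C2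
          + 4 * a1^2 * (p2 + 2 * q1^2 - (const C1 - 3 * sv)) / (f1 C1 C2)^2,
       q2 - 2 * a1 * (2 * p2 - 2 * q1^2 - (const C1 - 3 * sv)) / f1 C1 C2
          + 12 * a1^2 * q1 / (f1 C1 C2)^2 + 4 * a1^3 / (f1 C1 C2)^3,
       p2 - 4 * a1 * q1 / f1 C1 C2 - 2 * a1^2 / (f1 C1 C2)^2,
       tv, sv, a0 + 2 * a1, - a1] \<and>
    map \<pi> [q1, p1, q2, p2, tv, sv, a0, a1] =
      [- q1, - f1 C1 C2,
       - (q2 + 4 * q1 * (q1^2 + p2) - 2 * (const C1 - 3 * sv) * q1),
       - (p2 + 2 * q1^2 - const C1 + 3 * sv),
       tv, sv, a1, a0] \<and>
    baecklund C1 C2 s0 \<and> baecklund C1 C2 s1 \<and> baecklund C1 C2 \<pi> \<and>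
    s0 \<circ> s0 = id \<and> s1 \<circ> s1 = id \<and> \<pi> \<circ> \<pi> = id \<and> \<pi> \<circ> s0 = s1 \<circ> \<pi>"
proof -
  obtain s0 where s0: "is_hom s0" "\<And>c. s0 (const c) = const c" "\<And>v. s0 (X v) = s0_subst v"
    "s0 \<circ> s0 = id"
    using s0_exists by blast
  obtain \<pi> where \<pi>: "is_hom \<pi>" "\<And>c. \<pi> (const c) = const c" "\<And>v. \<pi> (X v) = pi_subst C1 C2 v"
    "\<pi> \<circ> \<pi> = id"
    using pi_exists by blast
  define s1 where "s1 = \<pi> \<circ> s0 \<circ> \<pi>"
  have s1: "is_hom s1" "s1 (const c) = const c" for c
    unfolding s1_def by (simp_all add: is_hom_comp s0 \<pi>)
  have \<pi>\<pi>: "\<pi> (\<pi> x) = x" and s0s0: "s0 (s0 x) = x" for x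
    using \<pi>(4) s0(4) by (metis comp_apply id_apply)+
  have rel: "s1 \<circ> s1 = id" "\<pi> \<circ> s0 = s1 \<circ> \<pi>"
    by (simp_all add: s1_def fun_eq_iff \<pi>\<pi> s0s0)
  note hom = is_hom_simps[OF s0(1)] is_hom_simps[OF \<pi>(1)] is_hom_divide[OF s0(1)]
    is_hom_divide[OF \<pi>(1)] s0(2,3) \<pi>(2,3)
  \<comment> \<open>\<open>l\<close> is the shift of q1 under \<open>s0\<close>, and
    \<open>k\<close> the one expected under \<open>s1\<close>; \<pi> turns \<open>l\<close> into
    \<open>- k\<close>.\<close>
  define l where "l = a0 / p1"
  define k where "k = a1 / f1 C1 C2"
  \<comment> \<open>These equations match the shapes of the quotients in the claimed formulas, which
    thus become polynomial in \<open>k\<close>.\<close>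
  have k: "a1 / f1 C1 C2 = k" "x * a1 * y / f1 C1 C2 = x * k * y"
    "x * a1^2 / (f1 C1 C2)^2 = x * k^2" "x * a1^2 * y / (f1 C1 C2)^2 = x * k^2 * y"
    "x * a1^3 / (f1 C1 C2)^3 = x * k^3" for x y
    by (simp_all add: k_def power_divide)
  have s0_X: "s0 q1 = q1 + l" "s0 p1 = p1" "s0 q2 = q2" "s0 p2 = p2" "s0 tv = tv" "s0 sv = sv"
    by (simp_all add: s0(3) l_def)
  note s0_simps = s0_X s0(2) is_hom_simps[OF s0(1)]
  have \<pi>_l: "\<pi> l = - k" by (simp add: hom l_def k_def)
  have \<pi>_f1: "\<pi> (f1 C1 C2) = - p1"
    \<comment> \<open>As \<pi> sends p1 to \<open>- f1\<close>, involutivity at p1 gives the image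
      of \<open>f1\<close> without expanding it.\<close>
    using \<pi>\<pi>[of p1] by (simp add: hom minus_equation_iff)
  have s0_f1: "s0 (f1 C1 C2) = f1 C1 C2 + 8 * q1 * l * p2 + 4 * l^2 * p2 + 4 * l * q2"
    by (simp add: f1_def s0_simps algebra_simps power2_eq_square)
  have "s1 q1 = q1 + k"
    by (simp add: s1_def \<pi>(3) s0_simps is_hom_simps[OF \<pi>(1)] \<pi>_l)
  moreover have "s1 p1 = p1 - 4 * k * (q2 + 2 * q1 * p2) + 4 * k^2 * (p2 + 2 * q1^2 - (const C1 - 3 * sv))"
  proof -
    \<comment> \<open>The inner \<pi> and \<open>s0\<close> are evaluated first, leaving a
      polynomial in \<open>l\<close> and in quantities whose images under the outer \<pi> are
      known.\<close>
    have "s1 p1 = \<pi> (- (f1 C1 C2 + 8 * q1 * l * p2 + 4 * l^2 * p2 + 4 * l * q2))"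
      by (simp add: s1_def \<pi>(3) s0_f1 s0_simps)
    also have "\<dots> = p1 - 4 * k * (q2 + 2 * q1 * p2) + 4 * k^2 * (p2 + 2 * q1^2 - (const C1 - 3 * sv))"
      by (simp add: is_hom_simps[OF \<pi>(1)] \<pi>_l \<pi>_f1 \<pi>(3))
        (simp add: algebra_simps power2_eq_square)
    finally show ?thesis .
  qed
  moreover have "s1 q2 = q2 - 2 * k * (2 * p2 - 2 * q1^2 - (const C1 - 3 * sv)) + 12 * k^2 * q1 + 4 * k^3"
  proof -
    have "s1 q2 = \<pi> (- (q2 + 4 * (q1 + l) * ((q1 + l)^2 + p2) - 2 * (const C1 - 3 * sv) * (q1 + l)))"
      by (simp add: s1_def \<pi>(3) s0_simps)
    also have "\<dots> = q2 - 2 * k * (2 * p2 - 2 * q1^2 - (const C1 - 3 * sv)) + 12 * k^2 * q1 + 4 * k^3"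
      by (simp add: is_hom_simps[OF \<pi>(1)] \<pi>_l \<pi>(2,3))
        (simp add: algebra_simps power2_eq_square power3_eq_cube)
    finally show ?thesis .
  qed
  moreover have "s1 p2 = p2 - 4 * k * q1 - 2 * k^2"
  proof -
    have "s1 p2 = \<pi> (- (p2 + 2 * (q1 + l)^2 - const C1 + 3 * sv))"
      by (simp add: s1_def \<pi>(3) s0_simps)
    also have "\<dots> = p2 - 4 * k * q1 - 2 * k^2"
      by (simp add: is_hom_simps[OF \<pi>(1)] \<pi>_l \<pi>(2,3))
        (simp add: algebra_simps power2_eq_square)
    finally show ?thesis .
  qed
  moreover have s1_fixed: "s1 tv = tv" "s1 sv = sv" and s1_a0: "s1 a0 = a0 + 2 * a1"
    by (simp_all add: s1_def hom)
  ultimately have s1_map: "map s1 [q1, p1, q2, p2, tv, sv, a0, a1] =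
      [q1 + a1 / f1 C1 C2,
       p1 - 4 * a1 * (q2 + 2 * q1 * p2) / f1 C1 C2
          + 4 * a1^2 * (p2 + 2 * q1^2 - (const C1 - 3 * sv)) / (f1 C1 C2)^2,
       q2 - 2 * a1 * (2 * p2 - 2 * q1^2 - (const C1 - 3 * sv)) / f1 C1 C2
          + 12 * a1^2 * q1 / (f1 C1 C2)^2 + 4 * a1^3 / (f1 C1 C2)^3,
       p2 - 4 * a1 * q1 / f1 C1 C2 - 2 * a1^2 / (f1 C1 C2)^2,
       tv, sv, a0 + 2 * a1, - a1]"
    \<comment> \<open>The entry for \<open>a1\<close>, which abbreviates \<open>1 - a0\<close>,
      follows from that for \<open>a0\<close>.\<close>
    unfolding list.map k by (simp add: is_hom_simps[OF s1(1)])
  have s0_map: "map s0 [q1, p1, q2, p2, tv, sv, a0, a1] =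
      [q1 + a0 / f0, p1, q2, p2, tv, sv, - a0, a1 + 2 * a0]"
    by (simp add: hom f0_def)
  have \<pi>_map: "map \<pi> [q1, p1, q2, p2, tv, sv, a0, a1] =
      [- q1, - f1 C1 C2, - (q2 + 4 * q1 * (q1^2 + p2) - 2 * (const C1 - 3 * sv) * q1),
       - (p2 + 2 * q1^2 - const C1 + 3 * sv), tv, sv, a1, a0]"
    by (simp add: hom)
  note flows = s0_preserves_flows[OF s0(1-3), of C1 C2] pi_preserves_flows[OF \<pi>(1-3)]
  have "baecklund C1 C2 s0"
  proof (rule baecklundI[OF s0(1,2,4) _ _ _ flows(1)])
    show "s0 a0 = param_poly (- [:0, 1:])"
      unfolding s0(3) s0_subst.simps is_hom_simps[OF is_hom_param_poly] param_poly_var ..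
  qed (simp_all add: s0(3))
  moreover have "baecklund C1 C2 \<pi>"
  proof (rule baecklundI[OF \<pi>(1,2,4) _ _ _ flows(2)])
    show "\<pi> a0 = param_poly (1 - [:0, 1:])"
      unfolding \<pi>(3) pi_subst.simps is_hom_simps[OF is_hom_param_poly] param_poly_var ..
  qed (simp_all add: \<pi>(3))
  moreover have "baecklund C1 C2 s1"
  proof (rule baecklundI[OF s1 rel(1) s1_fixed])
    show "preserves_flows C1 C2 s1"
      unfolding s1_def by (intro preserves_flows_comp flows)
    show "s1 a0 = param_poly ([:0, 1:] + 2 * (1 - [:0, 1:]))"
      unfolding s1_a0 is_hom_simps[OF is_hom_param_poly] param_poly_var ..
  qed
  ultimately show ?thesis
    by (intro exI[of _ s0] exI[of _ s1] exI[of _ \<pi>] conjI s0_map s1_map \<pi>_map s0(4) \<pi>(4) rel)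
qed

end
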